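(* For all $r\ge0$ we have $\mathcal S_r\subset\mathcal S_{r+1}$: every $r$-homotopy equivalence of twisted complexes is an $(r+1)$-homotopy equivalence.
   Context: $R$ is a commutative ring with unit. A bigraded module $A=\{A_i^j\}$ is a $(\mathbb Z,\mathbb Z)$-bigraded $R$-module; a map of bidegree $(p,q)$ sends $A_i^j$ to $A_{i+p}^{j+q}$. A twisted complex $(A,d_m)$ is a bigraded module $A$ with maps $d_m:A\to A$, $m\ge 0$, of bidegree $(-m,-m+1)$ such that $\sum_{i+j=m}(-1)^i d_id_j=0$ for all $m\ge0$. A morphism $f:(A,d^A_m)\to(B,d^B_m)$ is a family $f_m:A\to B$, $m\ge0$, of bidegree $(-m,-m)$ with $\sum_{i+j=m}d_i^Bf_j=\sum_{i+j=m}(-1)^if_id_j^A$ for all $m\geq 0$. Composition is $(g\circ f)_m=\sum_{i+j=m}g_if_j$; a morphism is strict if $f_m=0$ for $m>0$. The $r$-path of $(A,d_m)$ is the twisted complex $P_r(A)_i^j:=A_i^j\oplus A_{i+r}^{j+r-1}\oplus A_i^j$ with $D_r(x,y,z)=(d_rx,-x-d_ry+z,d_rz)$ and $D_m(x,y,z)=(d_mx,(-1)^{m+r+1}d_my,d_mz)$ for $m\ne r$; $\partial_A^-(x,y,z)=x$ and $\partial_A^+(x,y,z)=z$ are strict morphisms $P_r(A)\to A$. An $r$-homotopy from $f$ to $g$, where $f,g:A\to B$, is a morphism of twisted complexes $h:A\to P_r(B)$ with $\partial_B^-h=f$, $\partial_B^+h=g$; one writes $f\simeq_rg$. A morphism $f:A\to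 B$ is an $r$-homotopy equivalence if there is a morphism $g:B\to A$ with $fg\simeq_r1_B$ and $gf\simeq_r1_A$; $\mathcal S_r$ is the class of these. *)

theory Defs
  imports "HOL-Algebra.Module"
begin

text \<open>
  Modules over \<open>R\<close> are HOL-Algebra modules; the multiplicative record fields \<open>mult\<close> and \<open>one\<close>
  of a module carry no meaning.  A bigraded module is a family of modules \<open>M i j\<close>
  with lower index \<open>i\<close> and upper index \<open>j\<close>, whose carriers are sets over one common type.
\<close>

definition mod_hom ::
  "('r, 'q) ring_scheme \<Rightarrow> ('r, 'a) module \<Rightarrow> ('r, 'b) module \<Rightarrow> ('a \<Rightarrow> 'b) set" where
  "mod_hom R M N =
    {f \<in> carrier M \<rightarrow> carrier N.
       (\<forall>x\<in>carrier M. \<forall>y\<in>carrier M. f (x \<oplus>\<^bsub>M\<^esub> y) = f x \<oplus>\<^bsub>N\<^esub> f y) \<and>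
       (\<forall>c\<in>carrier R. \<forall>x\<in>carrier M. f (c \<odot>\<^bsub>M\<^esub> x) = c \<odot>\<^bsub>N\<^esub> f x)}"

definition direct_sum3 ::
  "('r, 'a) module \<Rightarrow> ('r, 'b) module \<Rightarrow> ('r, 'c) module \<Rightarrow> ('r, 'a \<times> 'b \<times> 'c) module" where
  "direct_sum3 L M N =
    \<lparr>carrier = carrier L \<times> carrier M \<times> carrier N,
     mult = (\<lambda>_ _. undefined),
     one = undefined,
     zero = (\<zero>\<^bsub>L\<^esub>, \<zero>\<^bsub>M\<^esub>, \<zero>\<^bsub>N\<^esub>),
     add = (\<lambda>(x, y, z) (x', y', z'). (x \<oplus>\<^bsub>L\<^esub> x', y \<oplus>\<^bsub>M\<^esub> y', z \<oplus>\<^bsub>N\<^esub> z')),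
     smult = (\<lambda>c (x, y, z). (c \<odot>\<^bsub>L\<^esub> x, c \<odot>\<^bsub>M\<^esub> y, c \<odot>\<^bsub>N\<^esub> z))\<rparr>"

definition signed :: "('r, 'a) module \<Rightarrow> nat \<Rightarrow> 'a \<Rightarrow> 'a" where
  \<comment> \<open>\<open>(-1)^n x\<close>\<close>
  "signed M n x = (if even n then x else \<ominus>\<^bsub>M\<^esub> x)"

text \<open>
  A sequence of maps is a function \<open>f\<close> such that \<open>f m i j\<close> is the component of \<open>f\<^sub>m\<close>
  on the summand of bidegree \<open>(i, j)\<close>.
\<close>

type_synonym ('a, 'b) map_seq = "nat \<Rightarrow> int \<Rightarrow> int \<Rightarrow> 'a \<Rightarrow> 'b"

record ('r, 'a) tw_data =
  obj :: "int \<Rightarrow> int \<Rightarrow> ('r, 'a) module"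
  dif :: "('a, 'a) map_seq"

definition twisted_complex :: "('r, 'q) ring_scheme \<Rightarrow> ('r, 'a) tw_data \<Rightarrow> bool" where
  "twisted_complex R A \<longleftrightarrow>
     cring R \<and>
     (\<forall>i j. module R (obj A i j)) \<and>
     (\<forall>m i j. dif A m i j \<in> mod_hom R (obj A i j) (obj A (i - int m) (j - int m + 1))) \<and>
     (\<forall>m i j. \<forall>x\<in>carrier (obj A i j).
        (\<Oplus>\<^bsub>obj A (i - int m) (j - int m + 2)\<^esub>k\<in>{..m}.
           signed (obj A (i - int m) (j - int m + 2)) k
             (dif A k (i - int (m - k)) (j - int (m - k) + 1) (dif A (m - k) i j x)))
        = \<zero>\<^bsub>obj A (i - int m) (j - int m + 2)\<^esub>)"

definition tw_morphism ::
  "('r, 'q) ring_scheme \<Rightarrow> ('r, 'a) tw_data \<Rightarrow> ('r, 'b) tw_data \<Rightarrow> ('a, 'b) map_seq \<Rightarrow> bool" where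
  "tw_morphism R A B f \<longleftrightarrow>
     (\<forall>m i j. f m i j \<in> mod_hom R (obj A i j) (obj B (i - int m) (j - int m))) \<and>
     (\<forall>m i j. \<forall>x\<in>carrier (obj A i j).
        (\<Oplus>\<^bsub>obj B (i - int m) (j - int m + 1)\<^esub>k\<in>{..m}.
           dif B k (i - int (m - k)) (j - int (m - k)) (f (m - k) i j x))
        = (\<Oplus>\<^bsub>obj B (i - int m) (j - int m + 1)\<^esub>k\<in>{..m}.
             signed (obj B (i - int m) (j - int m + 1)) k
               (f k (i - int (m - k)) (j - int (m - k) + 1) (dif A (m - k) i j x))))"

text \<open>Values outside the carriers are irrelevant, so morphisms are compared on carriers only.\<close>

definition same_mor ::
  "('r, 'a) tw_data \<Rightarrow> ('a, 'b) map_seq \<Rightarrow> ('a, 'b) map_seq \<Rightarrow> bool" where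
  "same_mor A f g \<longleftrightarrow> (\<forall>m i j. \<forall>x\<in>carrier (obj A i j). f m i j x = g m i j x)"

definition tw_comp ::
  "('r, 'c) tw_data \<Rightarrow> ('b, 'c) map_seq \<Rightarrow> ('a, 'b) map_seq \<Rightarrow> ('a, 'c) map_seq" where
  \<comment> \<open>The first argument is the target of the composite \<open>g \<circ> f\<close>.\<close>
  "tw_comp C g f = (\<lambda>m i j x.
     \<Oplus>\<^bsub>obj C (i - int m) (j - int m)\<^esub>k\<in>{..m}.
       g k (i - int (m - k)) (j - int (m - k)) (f (m - k) i j x))"

definition strict_mor ::
  "('r, 'b) tw_data \<Rightarrow> (int \<Rightarrow> int \<Rightarrow> 'a \<Rightarrow> 'b) \<Rightarrow> ('a, 'b) map_seq" where
  \<comment> \<open>The sequence \<open>(f, 0, 0, \<dots>)\<close> with target \<open>B\<close>.\<close>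
  "strict_mor B f = (\<lambda>m i j x. if m = 0 then f i j x else \<zero>\<^bsub>obj B (i - int m) (j - int m)\<^esub>)"

definition tw_id :: "('r, 'a) tw_data \<Rightarrow> ('a, 'a) map_seq" where
  "tw_id A = strict_mor A (\<lambda>i j x. x)"

definition r_path :: "nat \<Rightarrow> ('r, 'a) tw_data \<Rightarrow> ('r, 'a \<times> 'a \<times> 'a) tw_data" where
  "r_path r A =
    \<lparr>obj = (\<lambda>i j. direct_sum3 (obj A i j) (obj A (i + int r) (j + int r - 1)) (obj A i j)),
     dif = (\<lambda>m i j (x, y, z).
       let mid = obj A (i - int m + int r) (j - int m + int r);
           dy = dif A m (i + int r) (j + int r - 1) y
       in (dif A m i j x,
           if m = r then \<ominus>\<^bsub>mid\<^esub> x \<oplus>\<^bsub>mid\<^esub> \<ominus>\<^bsub>mid\<^esub> dy \<oplus>\<^bsub>mid\<^esub> z else signed mid (m + r + 1) dy,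
           dif A m i j z))\<rparr>"

definition path_minus :: "('r, 'a) tw_data \<Rightarrow> ('a \<times> 'a \<times> 'a, 'a) map_seq" where
  "path_minus A = strict_mor A (\<lambda>i j (x, y, z). x)"

definition path_plus :: "('r, 'a) tw_data \<Rightarrow> ('a \<times> 'a \<times> 'a, 'a) map_seq" where
  "path_plus A = strict_mor A (\<lambda>i j (x, y, z). z)"

definition is_homotopy ::
  "('r, 'q) ring_scheme \<Rightarrow> nat \<Rightarrow> ('r, 'a) tw_data \<Rightarrow> ('r, 'b) tw_data \<Rightarrow>
    ('a, 'b) map_seq \<Rightarrow> ('a, 'b) map_seq \<Rightarrow> ('a, 'b \<times> 'b \<times> 'b) map_seq \<Rightarrow> bool" where
  "is_homotopy R r A B f g h \<longleftrightarrow>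
     tw_morphism R A B f \<and> tw_morphism R A B g \<and>
     tw_morphism R A (r_path r B) h \<and>
     same_mor A (tw_comp B (path_minus B) h) f \<and>
     same_mor A (tw_comp B (path_plus B) h) g"

definition homotopic ::
  "('r, 'q) ring_scheme \<Rightarrow> nat \<Rightarrow> ('r, 'a) tw_data \<Rightarrow> ('r, 'b) tw_data \<Rightarrow>
    ('a, 'b) map_seq \<Rightarrow> ('a, 'b) map_seq \<Rightarrow> bool" where
  "homotopic R r A B f g \<longleftrightarrow> (\<exists>h. is_homotopy R r A B f g h)"

definition homotopy_equivalences ::
  "('r, 'q) ring_scheme \<Rightarrow> nat \<Rightarrow>
    (('r, 'a) tw_data \<times> ('r, 'b) tw_data \<times> ('a, 'b) map_seq) set" where
  \<comment> \<open>The class \<open>\<S>\<^sub>r\<close>, for twisted complexes over fixed carrier types.\<close>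
  "homotopy_equivalences R r =
    {(A, B, f). twisted_complex R A \<and> twisted_complex R B \<and> tw_morphism R A B f \<and>
       (\<exists>g. tw_morphism R B A g \<and>
            homotopic R r B B (tw_comp B f g) (tw_id B) \<and>
            homotopic R r A A (tw_comp A g f) (tw_id A))}"

end

(*
  An r-homotopy h from f to g has components (f, b, g) in the path P_r(B).  Shifting the middle
  component gives an (r+1)-homotopy from f to g with components (f_m, -b_(m-1), g_m), where
  b_(-1) = 0.
*)
theory Submission
  imports Defs
begin

section \<open>Module homomorphisms and threefold direct sums\<close>

lemma mod_hom_closed: "f \<in> mod_hom R M N \<Longrightarrow> x \<in> carrier M \<Longrightarrow> f x \<in> carrier N"
  by (auto simp: mod_hom_def)

lemma mod_hom_add:
  "f \<in> mod_hom R M N \<Longrightarrow> x \<in> carrier M \<Longrightarrow> y \<in> carrier M \<Longrightarrow> f (x \<oplus>\<^bsub>M\<^esub> y) = f x \<oplus>\<^bsub>N\<^esub> f y"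
  by (auto simp: mod_hom_def)

lemma mod_hom_zero:
  assumes "abelian_group M" "abelian_group N" "f \<in> mod_hom R M N"
  shows "f \<zero>\<^bsub>M\<^esub> = \<zero>\<^bsub>N\<^esub>"
proof -
  interpret M: abelian_group M by fact
  interpret N: abelian_group N by fact
  have c: "f \<zero>\<^bsub>M\<^esub> \<in> carrier N"
    using assms(3) by (simp add: mod_hom_closed)
  have "f \<zero>\<^bsub>M\<^esub> \<oplus>\<^bsub>N\<^esub> f \<zero>\<^bsub>M\<^esub> = f \<zero>\<^bsub>M\<^esub>"
    using mod_hom_add[OF assms(3), of "\<zero>\<^bsub>M\<^esub>" "\<zero>\<^bsub>M\<^esub>"] by simp
  then show ?thesis
    using c N.add.r_cancel_one by auto
qed

lemma mod_hom_a_inv: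
  assumes "abelian_group M" "abelian_group N" "f \<in> mod_hom R M N" "x \<in> carrier M"
  shows "f (\<ominus>\<^bsub>M\<^esub> x) = \<ominus>\<^bsub>N\<^esub> f x"
proof -
  interpret M: abelian_group M by fact
  interpret N: abelian_group N by fact
  have "f (\<ominus>\<^bsub>M\<^esub> x) \<oplus>\<^bsub>N\<^esub> f x = \<zero>\<^bsub>N\<^esub>"
    using mod_hom_add[OF assms(3), of "\<ominus>\<^bsub>M\<^esub> x" x] assms(4) mod_hom_zero[OF assms(1-3)]
    by (simp add: M.l_neg)
  then show ?thesis
    using assms(3,4) by (simp add: N.minus_equality mod_hom_closed)
qed

lemma mod_hom_zero_map:
  assumes "module R N"
  shows "(\<lambda>_. \<zero>\<^bsub>N\<^esub>) \<in> mod_hom R M N"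
proof -
  interpret N: module R N by fact
  show ?thesis by (auto simp: mod_hom_def)
qed

lemma mod_hom_uminus:
  assumes "module R N" "f \<in> mod_hom R M N"
  shows "(\<lambda>x. \<ominus>\<^bsub>N\<^esub> f x) \<in> mod_hom R M N"
proof -
  interpret N: module R N by fact
  show ?thesis
    using assms(2) by (auto simp: mod_hom_def Pi_def N.minus_add N.smult_r_minus)
qed

text \<open>Universal property of the product: all module operations of \<open>direct_sum3\<close>
  are componentwise. Hence the bidegree condition on a map into a path can be checked on its three
  components.\<close>

lemma mod_hom_direct_sum3_iff:
  "f \<in> mod_hom R M (direct_sum3 K L N) \<longleftrightarrow>
     (\<lambda>x. fst (f x)) \<in> mod_hom R M K \<and>
     (\<lambda>x. fst (snd (f x))) \<in> mod_hom R M L \<and>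
     (\<lambda>x. snd (snd (f x))) \<in> mod_hom R M N"
  by (auto simp: mod_hom_def direct_sum3_def Pi_def mem_Times_iff prod_eq_iff case_prod_unfold)

text \<open>Makes the laws of \<open>finsum\<close> and of inverses available in the objects of a
  path, where both sides of a morphism equation live.\<close>

lemma abelian_group_direct_sum3:
  assumes "abelian_group K" "abelian_group L" "abelian_group N"
  shows "abelian_group (direct_sum3 K L N)"
proof -
  interpret K: abelian_group K by fact
  interpret L: abelian_group L by fact
  interpret N: abelian_group N by fact
  show ?thesis
  proof (rule abelian_groupI)
    fix x assume "x \<in> carrier (direct_sum3 K L N)"
    then show "\<exists>y\<in>carrier (direct_sum3 K L N).
        y \<oplus>\<^bsub>direct_sum3 K L N\<^esub> x = \<zero>\<^bsub>direct_sum3 K L N\<^esub>"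
      by (intro bexI[of _ "(\<ominus>\<^bsub>K\<^esub> fst x, \<ominus>\<^bsub>L\<^esub> fst (snd x), \<ominus>\<^bsub>N\<^esub> snd (snd x))"])
         (auto simp: direct_sum3_def K.l_neg L.l_neg N.l_neg)
  qed (auto simp: direct_sum3_def K.a_ac L.a_ac N.a_ac)
qed

section \<open>Signs and finite sums in a direct sum\<close>

lemma signed_closed: "abelian_group M \<Longrightarrow> x \<in> carrier M \<Longrightarrow> signed M n x \<in> carrier M"
  by (simp add: signed_def abelian_group.a_inv_closed)

lemma signed_zero: "abelian_group M \<Longrightarrow> signed M n \<zero>\<^bsub>M\<^esub> = \<zero>\<^bsub>M\<^esub>"
  using abelian_group.minus_equality[of M "\<zero>\<^bsub>M\<^esub>" "\<zero>\<^bsub>M\<^esub>"]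
  by (simp add: signed_def abelian_group.axioms(1) abelian_monoid.zero_closed
      abelian_monoid.l_zero)

text \<open>Two minus signs cancel. This explains the minus in the shifted middle component: raising
  r by one flips the sign of every term d_k b, moving b_k to index k + 1 flips the sign of every
  term b_k d, and one minus corrects both.\<close>

lemma signed_Suc_uminus:
  "abelian_group M \<Longrightarrow> x \<in> carrier M \<Longrightarrow> signed M (Suc n) (\<ominus>\<^bsub>M\<^esub> x) = signed M n x"
  by (simp add: signed_def abelian_group.minus_minus)

lemma signed_direct_sum3:
  assumes "abelian_group K" "abelian_group L" "abelian_group N"
    and "u \<in> carrier (direct_sum3 K L N)"
  shows "signed (direct_sum3 K L N) n u =
    (signed K n (fst u), signed L n (fst (snd u)), signed N n (snd (snd u)))"
proof -
  interpret K: abelian_group K by fact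
  interpret L: abelian_group L by fact
  interpret N: abelian_group N by fact
  interpret D: abelian_group "direct_sum3 K L N"
    by (rule abelian_group_direct_sum3) fact+
  \<comment> \<open>Inverses are given by their characteristic property, so the componentwise
    candidate is verified to sum to zero with \<open>u\<close>.\<close>
  have "\<ominus>\<^bsub>direct_sum3 K L N\<^esub> u = (\<ominus>\<^bsub>K\<^esub> fst u, \<ominus>\<^bsub>L\<^esub> fst (snd u), \<ominus>\<^bsub>N\<^esub> snd (snd u))"
    using assms(4)
    by (intro D.minus_equality) (auto simp: direct_sum3_def K.l_neg L.l_neg N.l_neg)
  then show ?thesis
    by (simp add: signed_def)
qed

text \<open>Addition is componentwise, so induction on the index set splits the sum; values in the
  carrier are what allows a summand to be split off at each step.\<close>

lemma finsum_direct_sum3: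
  assumes "abelian_group K" "abelian_group L" "abelian_group N" and "finite I"
    and "f \<in> I \<rightarrow> carrier (direct_sum3 K L N)"
  shows "finsum (direct_sum3 K L N) f I =
    (finsum K (\<lambda>k. fst (f k)) I, finsum L (\<lambda>k. fst (snd (f k))) I,
     finsum N (\<lambda>k. snd (snd (f k))) I)"
proof -
  interpret K: abelian_group K by fact
  interpret L: abelian_group L by fact
  interpret N: abelian_group N by fact
  interpret D: abelian_group "direct_sum3 K L N"
    by (rule abelian_group_direct_sum3) fact+
  show ?thesis
    using assms(4,5)
  proof (induction I rule: finite_induct)
    case empty
    show ?case
      unfolding D.finsum_empty by (simp add: direct_sum3_def)
  next
    case (insert k I)
    have c: "fst (f i) \<in> carrier K" "fst (snd (f i)) \<in> carrier L" "snd (snd (f i)) \<in> carrier N"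
      if "i \<in> insert k I" for i
      using funcset_mem[OF insert.prems that] by (auto simp: direct_sum3_def)
    have "finsum (direct_sum3 K L N) f (insert k I) =
        f k \<oplus>\<^bsub>direct_sum3 K L N\<^esub> finsum (direct_sum3 K L N) f I"
      using insert.hyps insert.prems by (intro D.finsum_insert) auto
    also have "finsum (direct_sum3 K L N) f I =
        (finsum K (\<lambda>k. fst (f k)) I, finsum L (\<lambda>k. fst (snd (f k))) I,
         finsum N (\<lambda>k. snd (snd (f k))) I)"
      using insert by auto
    finally show ?case
      using insert.hyps c by (simp add: direct_sum3_def case_prod_unfold)
  qed
qed

section \<open>Morphisms into a path, by components\<close>

text \<open>
  The middle component of the morphism equations for a map \<open>(a, b, c)\<close> into \<open>P\<^sub>r(B)\<close>, with the
  summand \<open>c - a\<close> of the index \<open>r\<close> separated from the other terms; this makes the sign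
  \<open>(-1)^(k + r + 1)\<close> uniform in \<open>k\<close>.
\<close>

definition middle_eq ::
  "nat \<Rightarrow> ('r, 'a) tw_data \<Rightarrow> ('r, 'b) tw_data \<Rightarrow>
    ('a, 'b) map_seq \<Rightarrow> ('a, 'b) map_seq \<Rightarrow> ('a, 'b) map_seq \<Rightarrow>
    nat \<Rightarrow> int \<Rightarrow> int \<Rightarrow> 'a \<Rightarrow> bool" where
  "middle_eq r A B a b c m i j x \<longleftrightarrow>
     (let N = obj B (i - int m + int r) (j - int m + int r) in
       (\<Oplus>\<^bsub>N\<^esub>k\<in>{..m}. signed N (k + r + 1)
          (dif B k (i - int (m - k) + int r) (j - int (m - k) + int r - 1) (b (m - k) i j x)))
       \<oplus>\<^bsub>N\<^esub> (if r \<le> m then c (m - r) i j x \<ominus>\<^bsub>N\<^esub> a (m - r) i j x else \<zero>\<^bsub>N\<^esub>)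
       = (\<Oplus>\<^bsub>N\<^esub>k\<in>{..m}. signed N k
           (b k (i - int (m - k)) (j - int (m - k) + 1) (dif A (m - k) i j x))))"

text \<open>Extracts the extra summand that the differential of index r contributes to the middle
  component. Membership of \<open>y\<close> is asked only if \<open>k \<in> I\<close>: for r > m the
  truncated \<open>m - r\<close> is 0, so \<open>c (m - r) i j x\<close> need not lie in the middle
  object.\<close>

lemma (in abelian_group) finsum_add_at:
  assumes "finite I" "f \<in> I \<rightarrow> carrier G" "k \<in> I \<Longrightarrow> y \<in> carrier G"
  shows "(\<Oplus>i\<in>I. if i = k then f i \<oplus> y else f i) = finsum G f I \<oplus> (if k \<in> I then y else \<zero>)"
proof (cases "k \<in> I")
  case True
  \<comment> \<open>The sum becomes that of \<open>f\<close> plus a sum supported at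
    \<open>k\<close>; the condition is turned around to fit \<open>finsum_singleton\<close>.\<close>
  have "(\<Oplus>i\<in>I. if i = k then f i \<oplus> y else f i) = (\<Oplus>i\<in>I. f i \<oplus> (if k = i then y else \<zero>))"
    using assms True by (intro finsum_cong') (auto simp: Pi_def)
  also have "\<dots> = finsum G f I \<oplus> (\<Oplus>i\<in>I. if k = i then y else \<zero>)"
    using assms True by (intro finsum_addf) auto
  also have "(\<Oplus>i\<in>I. if k = i then y else \<zero>) = y"
    using assms True finsum_singleton[of k I "\<lambda>_. y"] by auto
  finally show ?thesis using True by simp
next
  case False
  have "(\<Oplus>i\<in>I. if i = k then f i \<oplus> y else f i) = finsum G f I"
    using assms False by (intro finsum_cong') auto
  then show ?thesis using assms False by simp
qed

lemma twisted_complexD: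
  assumes "twisted_complex R A"
  shows "module R (obj A i j)"
    and "abelian_group (obj A i j)"
    and "dif A m i j \<in> mod_hom R (obj A i j) (obj A (i - int m) (j - int m + 1))"
  using assms by (auto simp: twisted_complex_def module_def)

text \<open>The outer components of every D_m are just d_m, so the outer equations are the morphism
  equations of \<open>a\<close> and \<open>c\<close>. Only the middle component of D_r mixes the
  three, which leaves \<open>middle_eq\<close>. One direction takes a homotopy apart, the other
  assembles a new one.\<close>

lemma tw_morphism_r_path_iff:
  fixes h :: "('a, 'b \<times> 'b \<times> 'b) map_seq"
  assumes A: "twisted_complex R A" and B: "twisted_complex R B"
  defines "a \<equiv> \<lambda>m i j x. fst (h m i j x)"
    and "b \<equiv> \<lambda>m i j x. fst (snd (h m i j x))"
    and "c \<equiv> \<lambda>m i j x. snd (snd (h m i j x))"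
  shows "tw_morphism R A (r_path r B) h \<longleftrightarrow>
    tw_morphism R A B a \<and> tw_morphism R A B c \<and>
    (\<forall>m i j. b m i j \<in>
       mod_hom R (obj A i j) (obj B (i - int m + int r) (j - int m + int r - 1))) \<and>
    (\<forall>m i j. \<forall>x\<in>carrier (obj A i j). middle_eq r A B a b c m i j x)"
    (is "_ \<longleftrightarrow> ?rhs")
proof -
  note [simp] = twisted_complexD(2)[OF B]
  have hom: "(\<forall>m i j. h m i j \<in> mod_hom R (obj A i j) (obj (r_path r B) (i - int m) (j - int m)))
    \<longleftrightarrow> (\<forall>m i j. a m i j \<in> mod_hom R (obj A i j) (obj B (i - int m) (j - int m))) \<and>
      (\<forall>m i j. b m i j \<in>
         mod_hom R (obj A i j) (obj B (i - int m + int r) (j - int m + int r - 1))) \<and>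
      (\<forall>m i j. c m i j \<in> mod_hom R (obj A i j) (obj B (i - int m) (j - int m)))"
    (is "?H \<longleftrightarrow> ?Ha \<and> ?Hb \<and> ?Hc")
    by (auto simp: r_path_def mod_hom_direct_sum3_iff a_def b_def c_def)
  have eq: "(\<Oplus>\<^bsub>obj (r_path r B) (i - int m) (j - int m + 1)\<^esub>k\<in>{..m}.
           dif (r_path r B) k (i - int (m - k)) (j - int (m - k)) (h (m - k) i j x))
        = (\<Oplus>\<^bsub>obj (r_path r B) (i - int m) (j - int m + 1)\<^esub>k\<in>{..m}.
             signed (obj (r_path r B) (i - int m) (j - int m + 1)) k
               (h k (i - int (m - k)) (j - int (m - k) + 1) (dif A (m - k) i j x)))
     \<longleftrightarrow> (\<Oplus>\<^bsub>obj B (i - int m) (j - int m + 1)\<^esub>k\<in>{..m}.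
           dif B k (i - int (m - k)) (j - int (m - k)) (a (m - k) i j x))
        = (\<Oplus>\<^bsub>obj B (i - int m) (j - int m + 1)\<^esub>k\<in>{..m}.
             signed (obj B (i - int m) (j - int m + 1)) k
               (a k (i - int (m - k)) (j - int (m - k) + 1) (dif A (m - k) i j x))) \<and>
        (\<Oplus>\<^bsub>obj B (i - int m) (j - int m + 1)\<^esub>k\<in>{..m}.
           dif B k (i - int (m - k)) (j - int (m - k)) (c (m - k) i j x))
        = (\<Oplus>\<^bsub>obj B (i - int m) (j - int m + 1)\<^esub>k\<in>{..m}.
             signed (obj B (i - int m) (j - int m + 1)) k
               (c k (i - int (m - k)) (j - int (m - k) + 1) (dif A (m - k) i j x))) \<and>
        middle_eq r A B a b c m i j x"
    (is "finsum ?P ?l _ = finsum ?P ?s _ \<longleftrightarrow> _")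
    if H: ?Ha ?Hb ?Hc and x: "x \<in> carrier (obj A i j)" for m i j x
  proof -
    define K where "K = obj B (i - int m) (j - int m + 1)"
    define N where "N = obj B (i - int m + int r) (j - int m + int r)"
    interpret K: abelian_group K by (simp add: K_def)
    interpret N: abelian_group N by (simp add: N_def)
    \<comment> \<open>The definition of the path yields the upper index j - m + 1 + r - 1 here; it
      is normalized to the one used in \<open>middle_eq\<close>.\<close>
    have P: "?P = direct_sum3 K N K"
    proof -
      have "j - int m + 1 + int r - 1 = j - int m + int r" by simp
      then show ?thesis by (simp only: r_path_def K_def N_def tw_data.simps)
    qed
    define db where "db k =
      dif B k (i - int (m - k) + int r) (j - int (m - k) + int r - 1) (b (m - k) i j x)" for k
    have ac: "a n i j x \<in> carrier (obj B (i - int n) (j - int n))"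
      "c n i j x \<in> carrier (obj B (i - int n) (j - int n))"
      "b n i j x \<in> carrier (obj B (i - int n + int r) (j - int n + int r - 1))" for n
      by (rule H(1)[rule_format, THEN mod_hom_closed, OF x]
          H(3)[rule_format, THEN mod_hom_closed, OF x]
          H(2)[rule_format, THEN mod_hom_closed, OF x])+
    have db: "db k \<in> carrier N" if "k \<le> m" for k
    proof -
      have e: "i - int (m - k) + int r - int k = i - int m + int r"
        "j - int (m - k) + int r - 1 - int k + 1 = j - int m + int r"
        using that by (simp_all add: of_nat_diff)
      show ?thesis
        using mod_hom_closed[OF twisted_complexD(3)[OF B] ac(3)[of "m - k"], of k]
        by (simp only: db_def N_def e)
    qed
    have dac: "dif B k (i - int (m - k)) (j - int (m - k)) (a (m - k) i j x) \<in> carrier K"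
      "dif B k (i - int (m - k)) (j - int (m - k)) (c (m - k) i j x) \<in> carrier K"
      if "k \<le> m" for k
      using mod_hom_closed[OF twisted_complexD(3)[OF B] ac(1)[of "m - k"], of k]
        mod_hom_closed[OF twisted_complexD(3)[OF B] ac(2)[of "m - k"], of k] that
      by (simp_all add: K_def of_nat_diff)
    \<comment> \<open>For r \<le> m the subtraction \<open>m - r\<close> is exact, so the components
      of index m - r land in the middle object.\<close>
    have ca: "a (m - r) i j x \<in> carrier N" "c (m - r) i j x \<in> carrier N" if "r \<le> m"
    proof -
      have e: "i - int (m - r) = i - int m + int r" "j - int (m - r) = j - int m + int r"
        using that by (simp_all add: of_nat_diff)
      show "a (m - r) i j x \<in> carrier N" "c (m - r) i j x \<in> carrier N"
        using ac(1,2)[of "m - r"] by (simp_all only: N_def e)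
    qed
    \<comment> \<open>At k = r the exponent k + r + 1 is odd, so the uniform sign gives the term
      -d_r y of D_r, and what remains is z - x.\<close>
    have l: "?l k = (dif B k (i - int (m - k)) (j - int (m - k)) (a (m - k) i j x),
        if k = r then signed N (k + r + 1) (db k) \<oplus>\<^bsub>N\<^esub> (c (m - r) i j x \<ominus>\<^bsub>N\<^esub> a (m - r) i j x)
        else signed N (k + r + 1) (db k),
        dif B k (i - int (m - k)) (j - int (m - k)) (c (m - k) i j x))" if "k \<le> m" for k
    proof -
      have e: "i - int (m - k) - int k + int r = i - int m + int r"
        "j - int (m - k) - int k + int r = j - int m + int r"
        using that by (simp_all add: of_nat_diff)
      have h: "h (m - k) i j x = (a (m - k) i j x, b (m - k) i j x, c (m - k) i j x)"
        by (simp add: a_def b_def c_def)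
      have s: "\<ominus>\<^bsub>N\<^esub> a (m - r) i j x \<oplus>\<^bsub>N\<^esub> \<ominus>\<^bsub>N\<^esub> db r \<oplus>\<^bsub>N\<^esub> c (m - r) i j x =
          \<ominus>\<^bsub>N\<^esub> db r \<oplus>\<^bsub>N\<^esub> (c (m - r) i j x \<ominus>\<^bsub>N\<^esub> a (m - r) i j x)" if "r \<le> m"
        using ca[OF that] db[OF that] by (simp add: N.minus_eq N.a_ac)
      show ?thesis
        unfolding r_path_def h tw_data.simps prod.case Let_def e N_def[symmetric] db_def[symmetric]
        using s that by (auto simp: signed_def)
    qed
    have hs: "h k (i - int (m - k)) (j - int (m - k) + 1) (dif A (m - k) i j x)
        \<in> carrier (direct_sum3 K N K)" if "k \<le> m" for k
    proof -
      have "?H" using H hom by blast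
      then have "h k (i - int (m - k)) (j - int (m - k) + 1) (dif A (m - k) i j x)
        \<in> carrier (obj (r_path r B) (i - int (m - k) - int k) (j - int (m - k) + 1 - int k))"
        using mod_hom_closed[OF _ mod_hom_closed[OF twisted_complexD(3)[OF A] x]] by blast
      also have "i - int (m - k) - int k = i - int m"
        using that by (simp add: of_nat_diff)
      also have "j - int (m - k) + 1 - int k = j - int m + 1"
        using that by (simp add: of_nat_diff)
      finally show ?thesis by (simp add: P)
    qed
    have s: "?s k = (signed K k (a k (i - int (m - k)) (j - int (m - k) + 1) (dif A (m - k) i j x)),
        signed N k (b k (i - int (m - k)) (j - int (m - k) + 1) (dif A (m - k) i j x)),
        signed K k (c k (i - int (m - k)) (j - int (m - k) + 1) (dif A (m - k) i j x)))"
      if "k \<le> m" for k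
      using signed_direct_sum3[OF K.abelian_group_axioms N.abelian_group_axioms
          K.abelian_group_axioms hs[OF that]]
      by (simp add: P a_def b_def c_def)
    have lc: "?l \<in> {..m} \<rightarrow> carrier (direct_sum3 K N K)"
      using l dac db ca
      by (auto simp: direct_sum3_def
          intro!: signed_closed N.abelian_group_axioms N.a_closed N.minus_closed)
    have D: "abelian_group (direct_sum3 K N K)"
      by (intro abelian_group_direct_sum3 K.abelian_group_axioms N.abelian_group_axioms)
    have sc: "?s \<in> {..m} \<rightarrow> carrier (direct_sum3 K N K)"
      using hs by (auto simp: P intro!: signed_closed D)
    have cl: "fst (?l k) \<in> carrier K" "fst (snd (?l k)) \<in> carrier N" "snd (snd (?l k)) \<in> carrier K"
      "fst (?s k) \<in> carrier K" "fst (snd (?s k)) \<in> carrier N" "snd (snd (?s k)) \<in> carrier K"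
      if "k \<le> m" for k
      using funcset_mem[OF lc, of k] funcset_mem[OF sc, of k] that by (auto simp: direct_sum3_def)
    have lsum: "finsum ?P ?l {..m} =
       ((\<Oplus>\<^bsub>K\<^esub>k\<in>{..m}. dif B k (i - int (m - k)) (j - int (m - k)) (a (m - k) i j x)),
        (\<Oplus>\<^bsub>N\<^esub>k\<in>{..m}. if k = r
           then signed N (k + r + 1) (db k) \<oplus>\<^bsub>N\<^esub> (c (m - r) i j x \<ominus>\<^bsub>N\<^esub> a (m - r) i j x)
           else signed N (k + r + 1) (db k)),
        (\<Oplus>\<^bsub>K\<^esub>k\<in>{..m}. dif B k (i - int (m - k)) (j - int (m - k)) (c (m - k) i j x)))"
      unfolding P finsum_direct_sum3[OF K.abelian_group_axioms N.abelian_group_axioms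
          K.abelian_group_axioms finite_atMost lc] prod.inject
      using cl l
      by (intro conjI K.finsum_cong' N.finsum_cong') (auto simp del: if_split_mem2)
    have ssum: "finsum ?P ?s {..m} =
       ((\<Oplus>\<^bsub>K\<^esub>k\<in>{..m}. signed K k
           (a k (i - int (m - k)) (j - int (m - k) + 1) (dif A (m - k) i j x))),
        (\<Oplus>\<^bsub>N\<^esub>k\<in>{..m}. signed N k
           (b k (i - int (m - k)) (j - int (m - k) + 1) (dif A (m - k) i j x))),
        (\<Oplus>\<^bsub>K\<^esub>k\<in>{..m}. signed K k
           (c k (i - int (m - k)) (j - int (m - k) + 1) (dif A (m - k) i j x))))"
      unfolding finsum_direct_sum3[OF K.abelian_group_axioms N.abelian_group_axioms
          K.abelian_group_axioms finite_atMost sc, folded P] prod.inject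
      using cl s
      by (intro conjI K.finsum_cong' N.finsum_cong') (auto simp: P)
    have mid: "(\<Oplus>\<^bsub>N\<^esub>k\<in>{..m}. if k = r
           then signed N (k + r + 1) (db k) \<oplus>\<^bsub>N\<^esub> (c (m - r) i j x \<ominus>\<^bsub>N\<^esub> a (m - r) i j x)
           else signed N (k + r + 1) (db k)) =
        (\<Oplus>\<^bsub>N\<^esub>k\<in>{..m}. signed N (k + r + 1) (db k)) \<oplus>\<^bsub>N\<^esub>
          (if r \<le> m then c (m - r) i j x \<ominus>\<^bsub>N\<^esub> a (m - r) i j x else \<zero>\<^bsub>N\<^esub>)"
      using db ca
      by (intro N.finsum_add_at[of "{..m}" _ r, unfolded atMost_iff])
         (auto intro!: signed_closed N.abelian_group_axioms)
    show ?thesis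
      unfolding lsum ssum mid prod.inject middle_eq_def Let_def K_def[symmetric] N_def[symmetric]
        db_def[symmetric]
      by blast
  qed
  \<comment> \<open>The sums split only if the three components have the right bidegrees. If one of
    them has not, both sides of the equivalence fail.\<close>
  show ?thesis
  proof (cases "?Ha \<and> ?Hb \<and> ?Hc")
    case True
    then have H: ?Ha ?Hb ?Hc by simp_all
    show ?thesis
      unfolding tw_morphism_def hom
      by (simp only: H eq[OF H] ball_conj_distrib all_conj_distrib simp_thms cong: ball_cong)
  next
    case False
    have "\<not> tw_morphism R A (r_path r B) h"
      using False unfolding tw_morphism_def hom by (elim contrapos_nn conjunct1)
    moreover have "\<not> ?rhs"
      using False
    proof (rule contrapos_nn)
      assume rhs: ?rhs
      show "?Ha \<and> ?Hb \<and> ?Hc"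
        using conjunct1[OF rhs] conjunct1[OF conjunct2[OF rhs]]
          conjunct1[OF conjunct2[OF conjunct2[OF rhs]]]
        unfolding tw_morphism_def by (simp only: simp_thms)
    qed
    ultimately show ?thesis by (simp only: simp_thms)
  qed
qed

section \<open>The shift of the middle component\<close>

text \<open>With b'_m = -b_(m-1), the equation of index m for r + 1 is the equation of index m - 1
  for r, term by term, and the equation of index 0 is trivial.\<close>

lemma middle_eq_shift:
  assumes A: "twisted_complex R A" and B: "twisted_complex R B"
    and b: "\<And>m i j. b m i j \<in>
       mod_hom R (obj A i j) (obj B (i - int m + int r) (j - int m + int r - 1))"
    and eq: "\<And>m i j x. x \<in> carrier (obj A i j) \<Longrightarrow> middle_eq r A B a b c m i j x"
    and b'_0: "\<And>i j x. b' 0 i j x = \<zero>\<^bsub>obj B (i + int r + 1) (j + int r)\<^esub>"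
    and b'_Suc: "\<And>n i j x.
       b' (Suc n) i j x = \<ominus>\<^bsub>obj B (i - int n + int r) (j - int n + int r - 1)\<^esub> b n i j x"
    and x: "x \<in> carrier (obj A i j)"
  shows "middle_eq (Suc r) A B a b' c m i j x"
proof (cases m)
  \<comment> \<open>Every term contains b'_0 = 0, and the difference of \<open>c\<close> and
    \<open>a\<close> is absent because r + 1 > 0.\<close>
  case 0
  define N where "N = obj B (i + int r + 1) (j + int r + 1)"
  interpret N: abelian_group N
    unfolding N_def by (rule twisted_complexD(2)[OF B])
  have N: "obj B (i - int 0 + int (Suc r)) (j - int 0 + int (Suc r)) = N"
    by (simp add: N_def algebra_simps)
  have db': "dif B 0 (i - int 0 + int (Suc r)) (j - int 0 + int (Suc r) - 1) (b' 0 i j x) =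
      \<zero>\<^bsub>N\<^esub>"
    using mod_hom_zero[OF twisted_complexD(2)[OF B] twisted_complexD(2)[OF B]
        twisted_complexD(3)[OF B], of 0 "i + int r + 1" "j + int r"]
    by (simp add: b'_0 N_def algebra_simps)
  have bd': "b' 0 (i - int 0) (j - int 0 + 1) (dif A 0 i j x) = \<zero>\<^bsub>N\<^esub>"
    by (simp add: b'_0 N_def algebra_simps)
  show ?thesis
    using db' bd' unfolding 0 middle_eq_def Let_def N
    by (simp add: signed_zero N.abelian_group_axioms)
next
  case (Suc n)
  define N where "N = obj B (i - int n + int r) (j - int n + int r)"
  interpret N: abelian_group N
    unfolding N_def by (rule twisted_complexD(2)[OF B])
  \<comment> \<open>Bidegrees depend only on r - m here, so raising both by one leaves the middle
    object unchanged.\<close>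
  have N: "obj B (i - int m + int (Suc r)) (j - int m + int (Suc r)) = N"
    by (simp add: Suc N_def algebra_simps)
  have bx: "b k i j x \<in> carrier (obj B (i - int k + int r) (j - int k + int r - 1))" for k
    using b x by (rule mod_hom_closed)
  define db where "db k =
    dif B k (i - int (n - k) + int r) (j - int (n - k) + int r - 1) (b (n - k) i j x)" for k
  define bd where "bd k =
    b k (i - int (n - k)) (j - int (n - k) + 1) (dif A (n - k) i j x)" for k
  have e: "i - int (n - k) + int r - int k = i - int n + int r"
    "j - int (n - k) + int r - 1 - int k + 1 = j - int n + int r"
    "i - int (n - k) - int k + int r = i - int n + int r"
    "j - int (n - k) + 1 - int k + int r - 1 = j - int n + int r" if "k \<le> n" for k
    using that by (simp_all add: of_nat_diff)
  have db: "db k \<in> carrier N" if "k \<le> n" for k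
    using mod_hom_closed[OF twisted_complexD(3)[OF B] bx[of "n - k"], of k] e[OF that]
    by (simp only: db_def N_def)
  have bd: "bd k \<in> carrier N" if "k \<le> n" for k
    using mod_hom_closed[OF b mod_hom_closed[OF twisted_complexD(3)[OF A] x], of k "n - k"]
      e[OF that]
    by (simp only: bd_def N_def)
  have db': "dif B k (i - int (m - k) + int (Suc r)) (j - int (m - k) + int (Suc r) - 1)
      (b' (m - k) i j x) = \<ominus>\<^bsub>N\<^esub> db k" if "k \<le> n" for k
  proof -
    \<comment> \<open>These index equations mention \<open>m - k\<close> and are therefore applied
      before \<open>m\<close> rewrites it.\<close>
    have i: "i - int (m - k) + int (Suc r) = i - int (n - k) + int r"
      "j - int (m - k) + int (Suc r) - 1 = j - int (n - k) + int r - 1"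
      and m: "m - k = Suc (n - k)"
      using that Suc by simp_all
    show ?thesis
      using mod_hom_a_inv[OF twisted_complexD(2)[OF B] twisted_complexD(2)[OF B]
        twisted_complexD(3)[OF B] bx[of "n - k"], of k] e[OF that]
      unfolding i unfolding m b'_Suc by (simp only: db_def N_def)
  qed
  \<comment> \<open>The term b'_0 occurs at the top index k = m on the left-hand side and at the
    bottom index k = 0 on the right-hand side.\<close>
  have db'_last: "dif B m (i - int (m - m) + int (Suc r)) (j - int (m - m) + int (Suc r) - 1)
      (b' (m - m) i j x) = \<zero>\<^bsub>N\<^esub>"
    using mod_hom_zero[OF twisted_complexD(2)[OF B] twisted_complexD(2)[OF B]
        twisted_complexD(3)[OF B], of m "i + int r + 1" "j + int r"]
    by (simp add: b'_0 Suc N_def algebra_simps)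
  have bd'_0: "b' 0 (i - int (m - 0)) (j - int (m - 0) + 1) (dif A (m - 0) i j x) = \<zero>\<^bsub>N\<^esub>"
    by (simp add: b'_0 Suc N_def algebra_simps)
  have bd'_Suc: "b' (Suc k) (i - int (m - Suc k)) (j - int (m - Suc k) + 1)
      (dif A (m - Suc k) i j x) = \<ominus>\<^bsub>N\<^esub> bd k" if "k \<le> n" for k
  proof -
    have m: "m - Suc k = n - k" using Suc by simp
    show ?thesis
      unfolding m b'_Suc by (simp only: e[OF that] bd_def N_def)
  qed
  have "(\<Oplus>\<^bsub>N\<^esub>k\<in>{..m}. signed N (k + Suc r + 1)
          (dif B k (i - int (m - k) + int (Suc r)) (j - int (m - k) + int (Suc r) - 1)
            (b' (m - k) i j x))) =
      (\<Oplus>\<^bsub>N\<^esub>k\<in>{..m}. if k \<le> n then signed N (k + r + 1) (db k) else \<zero>\<^bsub>N\<^esub>)"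
  proof (rule N.finsum_cong')
    fix k assume "k \<in> {..m}"
    then consider "k \<le> n" | "k = m" "\<not> k \<le> n" using Suc by force
    then show "signed N (k + Suc r + 1)
          (dif B k (i - int (m - k) + int (Suc r)) (j - int (m - k) + int (Suc r) - 1)
            (b' (m - k) i j x)) = (if k \<le> n then signed N (k + r + 1) (db k) else \<zero>\<^bsub>N\<^esub>)"
    proof cases
      case 1
      then show ?thesis
        unfolding db'[OF 1]
        using signed_Suc_uminus[OF N.abelian_group_axioms db[OF 1], of "k + r + 1"] by simp
    next
      case 2
      then show ?thesis
        using db'_last signed_zero[OF N.abelian_group_axioms] by (simp only: if_False)
    qed
  qed (auto intro!: signed_closed N.abelian_group_axioms db)
  \<comment> \<open>The summand at m = n + 1 has the default value zero and drops out; the indices k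
    \<le> n keep their place.\<close>
  also have "\<dots> = (\<Oplus>\<^bsub>N\<^esub>k\<in>{..n}. if k \<le> n then signed N (k + r + 1) (db k) else \<zero>\<^bsub>N\<^esub>)"
    unfolding Suc
    by (subst N.finsum_Suc)
       (auto intro!: signed_closed N.abelian_group_axioms db N.l_zero N.finsum_closed)
  also have "\<dots> = (\<Oplus>\<^bsub>N\<^esub>k\<in>{..n}. signed N (k + r + 1) (db k))"
    by (rule N.finsum_cong') (auto intro!: signed_closed N.abelian_group_axioms db)
  finally have lhs: "(\<Oplus>\<^bsub>N\<^esub>k\<in>{..m}. signed N (k + Suc r + 1)
          (dif B k (i - int (m - k) + int (Suc r)) (j - int (m - k) + int (Suc r) - 1)
            (b' (m - k) i j x))) = (\<Oplus>\<^bsub>N\<^esub>k\<in>{..n}. signed N (k + r + 1) (db k))" .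
  \<comment> \<open>On the right the summand at 0 vanishes instead, so the rest is reindexed from
    \<open>Suc k\<close> to \<open>k\<close> by \<open>finsum_Suc2\<close>.\<close>
  define s where "s k = signed N k
      (b' k (i - int (m - k)) (j - int (m - k) + 1) (dif A (m - k) i j x))" for k
  have s0: "s 0 = \<zero>\<^bsub>N\<^esub>"
    unfolding s_def bd'_0 by (rule signed_zero) (rule N.abelian_group_axioms)
  have sSuc: "s (Suc k) = signed N k (bd k)" if "k \<le> n" for k
    unfolding s_def bd'_Suc[OF that]
    by (rule signed_Suc_uminus) (use bd that N.abelian_group_axioms in auto)
  have sc: "s k \<in> carrier N" if "k \<le> m" for k
    using that s0 sSuc bd Suc
    by (cases k) (auto intro!: signed_closed N.abelian_group_axioms)
  have "finsum N s {..m} = (\<Oplus>\<^bsub>N\<^esub>k\<in>{..n}. s (Suc k))"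
    using sc unfolding Suc by (subst N.finsum_Suc2) (auto simp: s0 Pi_def)
  also have "\<dots> = (\<Oplus>\<^bsub>N\<^esub>k\<in>{..n}. signed N k (bd k))"
    using sSuc by (intro N.finsum_cong') (auto intro!: signed_closed N.abelian_group_axioms bd)
  finally have rhs: "finsum N s {..m} = (\<Oplus>\<^bsub>N\<^esub>k\<in>{..n}. signed N k (bd k))" .
  \<comment> \<open>The difference of \<open>c\<close> and \<open>a\<close> keeps its index, since m
    - (r + 1) = n - r; what is left is the old equation of index n.\<close>
  have le: "Suc r \<le> m \<longleftrightarrow> r \<le> n" and mr: "m - Suc r = n - r"
    using Suc by auto
  show ?thesis
    using eq[OF x, of n] rhs
    unfolding middle_eq_def Let_def N N_def[symmetric] lhs s_def db_def[symmetric]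
      bd_def[symmetric] le mr
    by simp
qed

section \<open>Raising r for homotopies and equivalences\<close>

lemma homotopic_Suc:
  assumes A: "twisted_complex R A" and B: "twisted_complex R B"
    and "homotopic R r A B f g"
  shows "homotopic R (Suc r) A B f g"
proof -
  obtain h where h: "is_homotopy R r A B f g h"
    using assms(3) by (auto simp: homotopic_def)
  define b where "b m i j x = fst (snd (h m i j x))" for m i j x
  \<comment> \<open>The value at index 0 is the zero of the target of b'_0 in the (r+1)-path; each
    negation is taken in the object where b_n lands.\<close>
  define b' where "b' m i j x =
    (case m of 0 \<Rightarrow> \<zero>\<^bsub>obj B (i + int r + 1) (j + int r)\<^esub>
     | Suc n \<Rightarrow> \<ominus>\<^bsub>obj B (i - int n + int r) (j - int n + int r - 1)\<^esub> b n i j x)" for m i j x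
  define h' where "h' m i j x = (fst (h m i j x), b' m i j x, snd (snd (h m i j x)))" for m i j x
  have h'_outer: "fst (h' m i j x) = fst (h m i j x)"
    "snd (snd (h' m i j x)) = snd (snd (h m i j x))" for m i j x
    by (simp_all add: h'_def)
  have b'_0: "b' 0 i j x = \<zero>\<^bsub>obj B (i + int r + 1) (j + int r)\<^esub>"
    and b'_Suc: "b' (Suc n) i j x =
      \<ominus>\<^bsub>obj B (i - int n + int r) (j - int n + int r - 1)\<^esub> b n i j x" for n i j x
    by (simp_all add: b'_def)
  have "tw_morphism R A (r_path r B) h"
    using h by (simp add: is_homotopy_def)
  then have a: "tw_morphism R A B (\<lambda>m i j x. fst (h m i j x))"
    and c: "tw_morphism R A B (\<lambda>m i j x. snd (snd (h m i j x)))"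
    and b: "b m i j \<in>
       mod_hom R (obj A i j) (obj B (i - int m + int r) (j - int m + int r - 1))"
    and mid: "x \<in> carrier (obj A i j) \<Longrightarrow> middle_eq r A B (\<lambda>m i j x. fst (h m i j x)) b
      (\<lambda>m i j x. snd (snd (h m i j x))) m i j x" for m i j x
    unfolding tw_morphism_r_path_iff[OF A B] b_def[abs_def] by blast+
  have b': "b' m i j \<in>
      mod_hom R (obj A i j) (obj B (i - int m + int (Suc r)) (j - int m + int (Suc r) - 1))"
    for m i j
  proof (cases m)
    case 0
    have "b' m i j = (\<lambda>_. \<zero>\<^bsub>obj B (i - int m + int (Suc r)) (j - int m + int (Suc r) - 1)\<^esub>)"
      by (simp add: 0 b'_0 fun_eq_iff algebra_simps)
    then show ?thesis
      using mod_hom_zero_map[OF twisted_complexD(1)[OF B]] by simp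
  next
    case (Suc n)
    \<comment> \<open>The target of b'_(n+1) for r + 1 is that of b_n for r, so negation gives a map
      of the right bidegree.\<close>
    have e: "i - int m + int (Suc r) = i - int n + int r"
      "j - int m + int (Suc r) - 1 = j - int n + int r - 1"
      by (simp_all add: Suc)
    show ?thesis
      unfolding e unfolding Suc b'_Suc[abs_def]
      by (rule mod_hom_uminus[OF twisted_complexD(1)[OF B] b])
  qed
  have "tw_morphism R A (r_path (Suc r) B) h'"
    unfolding tw_morphism_r_path_iff[OF A B] h'_def fst_conv snd_conv
    using a c b' middle_eq_shift[OF A B b mid b'_0 b'_Suc] by blast
  \<comment> \<open>The projections read only the outer components, which \<open>h'\<close> shares
    with \<open>h\<close>, so the endpoints are unchanged.\<close>
  moreover have "tw_comp B (path_minus B) h' = tw_comp B (path_minus B) h"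
    and "tw_comp B (path_plus B) h' = tw_comp B (path_plus B) h"
    using h'_outer
    by (simp_all add: tw_comp_def path_minus_def path_plus_def strict_mor_def case_prod_unfold
        cong: if_cong)
  ultimately have "is_homotopy R (Suc r) A B f g h'"
    using h by (simp add: is_homotopy_def)
  then show ?thesis
    by (auto simp: homotopic_def)
qed

text \<open>The same homotopy inverse serves for r + 1: \<open>homotopic_Suc\<close> raises both
  homotopies to the identities.\<close>

theorem proposition3p23:
  fixes R :: "('r, 'q) ring_scheme"
  assumes "cring R"
  shows "\<forall>r. (homotopy_equivalences R r ::
            (('r, 'a) tw_data \<times> ('r, 'b) tw_data \<times> ('a, 'b) map_seq) set)
          \<subseteq> homotopy_equivalences R (r + 1)"
  by (auto simp: homotopy_equivalences_def intro: homotopic_Suc)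

end
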